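(* Let $\mathcal{D}$ be a finite collection of datasets, each dataset $D\in\mathcal{D}$ having a finite schema set $D.\mathrm{schema}$, and let $G$ be the directed graph on $\mathcal{D}$ output by the algorithm SGB (Schema Graph Builder, defined in the context) on this collection. Then $G$ is not missing any correct containment edge: for all distinct $A,B\in\mathcal{D}$ with $A.\mathrm{schema}\subseteq B.\mathrm{schema}$, the directed edge $B\to A$ belongs to $G$.
   Context: Each dataset (table) $D$ has a schema, represented by a finite set $D.\mathrm{schema}$ of (flattened) column names; the size of a schema is the cardinality of this set. The datasets' schemas are treated as a list indexed by datasets, so distinct datasets may have equal schema sets. A (correct) containment edge $B\to A$ between distinct datasets means $A.\mathrm{schema}\subseteq B.\mathrm{schema}$. Algorithm SGB. Input: the list of schemas of the datasets. 1. Sort the list of schemas in non-increasing order of size (ties broken arbitrarily). 2. Start with an empty list of clusters. A cluster consists of a center (a schema) and a list of members (schemas); the center is itself a member of its cluster. 3. Traverse the schemas in the sorted order. For the current schema $s$, compare $s$ with the center of every currently existing cluster. For each cluster whose center $cc$ satisfies $s\subseteq cc$, add $s$ as a member of that cluster (so $s$ may become a member of several clusters). If $s$ is contained in no current center, create a new cluster with center $s$ (and $s$ as a member). 4. After the traversal, for every cluster and every pair of distinct entries $x,y$ among its members (including the center), if $y\subseteq x$ then add to $G$ the directed edge from the dataset of $x$ to the dataset of $y$. Output: the resulting directed graph $G$ whose vertices are the datasets. *)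

theory Defs
  imports "Graph_Theory.Pair_Digraph"
begin

text \<open>
  The list of schemas is indexed by the datasets, so an entry of that list is represented by its
  dataset \<open>x :: 'd\<close>, the schema itself being \<open>schema x :: 'c set\<close>.  Entries belonging to different
  datasets are thus different even if their schema sets coincide.
\<close>

record 'd cluster =
  center :: 'd
  members :: "'d list"

definition sgb_order :: "('d \<Rightarrow> 'c set) \<Rightarrow> 'd set \<Rightarrow> 'd list \<Rightarrow> bool" where
  "sgb_order schema DS xs \<longleftrightarrow>
     set xs = DS \<and> distinct xs \<and>
     sorted_wrt (\<lambda>x y. card (schema y) \<le> card (schema x)) xs"

definition sgb_insert ::
    "('d \<Rightarrow> 'c set) \<Rightarrow> 'd \<Rightarrow> 'd cluster list \<Rightarrow> 'd cluster list" where
  "sgb_insert schema s cs =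
     (if \<exists>C \<in> set cs. schema s \<subseteq> schema (center C)
      then map (\<lambda>C. if schema s \<subseteq> schema (center C)
                     then C\<lparr>members := members C @ [s]\<rparr> else C) cs
      else cs @ [\<lparr>center = s, members = [s]\<rparr>])"

definition sgb_clusters :: "('d \<Rightarrow> 'c set) \<Rightarrow> 'd list \<Rightarrow> 'd cluster list" where
  "sgb_clusters schema xs = fold (sgb_insert schema) xs []"

definition sgb_graph :: "('d \<Rightarrow> 'c set) \<Rightarrow> 'd list \<Rightarrow> 'd pair_pre_digraph" where
  "sgb_graph schema xs =
     \<lparr>pverts = set xs,
      parcs = {(x, y). \<exists>C \<in> set (sgb_clusters schema xs).
                 x \<in> set (members C) \<and> y \<in> set (members C) \<and>
                 x \<noteq> y \<and> schema y \<subseteq> schema x}\<rparr>"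

text \<open>
  Ties in the sorting step are broken arbitrarily, so the output is a relation: \<open>G\<close> is a possible
  output iff it results from some admissible order.
\<close>

definition sgb_output ::
    "('d \<Rightarrow> 'c set) \<Rightarrow> 'd set \<Rightarrow> 'd pair_pre_digraph \<Rightarrow> bool" where
  "sgb_output schema DS G \<longleftrightarrow> (\<exists>xs. sgb_order schema DS xs \<and> G = sgb_graph schema xs)"

lemma sgb_output_exists:
  assumes "finite DS"
  shows "\<exists>G. sgb_output schema DS G"
proof -
  obtain ds where ds: "set ds = DS" "distinct ds"
    using finite_distinct_list[OF assms] by blast
  let ?xs = "rev (sort_key (\<lambda>x. card (schema x)) ds)"
  have "sorted (map (\<lambda>x. card (schema x)) (sort_key (\<lambda>x. card (schema x)) ds))"
    by (rule sorted_sort_key)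
  then have "sorted_wrt (\<lambda>x y. card (schema y) \<le> card (schema x)) ?xs"
    by (simp add: sorted_wrt_rev sorted_wrt_map)
  with ds have "sgb_order schema DS ?xs"
    by (simp add: sgb_order_def)
  then show ?thesis
    by (auto simp: sgb_output_def)
qed

end

theory Submission
  imports Defs
begin

text \<open>
  A schema contained in a member of a cluster is contained in its center as well, so an entry joins
  every cluster that already has a member containing it.  Since the schemas are traversed by
  non-increasing size, an entry can only contain an earlier one if the two schemas are equal;
  hence any two comparable entries share a cluster as soon as the later one has been inserted.
\<close>

lemma sgb_clusters_Nil [simp]: "sgb_clusters schema [] = []"
  by (simp add: sgb_clusters_def)

text \<open>\<open>fold\<close> runs from the left, so the last entry of the list is the last one
  inserted; this equation drives the inductions by \<open>rev_induct\<close>.\<close>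

lemma sgb_clusters_snoc [simp]:
  "sgb_clusters schema (xs @ [s]) = sgb_insert schema s (sgb_clusters schema xs)"
  by (simp add: sgb_clusters_def)

lemma sgb_insert_cases:
  assumes "C \<in> set (sgb_insert schema s cs)"
  obtains (old) "C \<in> set cs"
    | (new) "C = \<lparr>center = s, members = [s]\<rparr>"
    | (joined) C' where "C' \<in> set cs" "schema s \<subseteq> schema (center C')"
        "C = C'\<lparr>members := members C' @ [s]\<rparr>"
  using assms unfolding sgb_insert_def by (auto split: if_splits)

text \<open>Centers never change once created, and an entry joins an existing cluster only after
  passing the test against its center.\<close>

lemma sgb_clusters_member_subset_center:
  assumes "C \<in> set (sgb_clusters schema xs)" and "x \<in> set (members C)"
  shows "schema x \<subseteq> schema (center C)"
  using assms
proof (induction xs arbitrary: C x rule: rev_induct)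
  case Nil
  then show ?case by simp
next
  case (snoc s xs)
  from snoc.prems(1) have "C \<in> set (sgb_insert schema s (sgb_clusters schema xs))"
    by simp
  then show ?case
  proof (cases rule: sgb_insert_cases)
    case old
    then show ?thesis using snoc.IH snoc.prems(2) by blast
  next
    case new
    then show ?thesis using snoc.prems(2) by simp
  next
    case (joined C')
    then have "x = s \<or> x \<in> set (members C')"
      using snoc.prems(2) by auto
    then have "schema x \<subseteq> schema (center C')"
      using joined(1,2) snoc.IH by metis
    then show ?thesis using joined(3) by simp
  qed
qed

lemma sgb_insert_joins:
  assumes "C \<in> set cs" and "schema s \<subseteq> schema (center C)"
  shows "\<exists>C' \<in> set (sgb_insert schema s cs). insert s (set (members C)) \<subseteq> set (members C')"
proof (rule bexI)
  show "C\<lparr>members := members C @ [s]\<rparr> \<in> set (sgb_insert schema s cs)"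
    using assms by (auto simp: sgb_insert_def)
qed simp

text \<open>An insertion may replace the record \<open>C\<close> by an extended one, so the
  persistence of a cluster is expressed through its member set.\<close>

lemma sgb_insert_members_mono:
  assumes "C \<in> set cs"
  shows "\<exists>C' \<in> set (sgb_insert schema s cs). set (members C) \<subseteq> set (members C')"
proof (cases "schema s \<subseteq> schema (center C)")
  case True
  then show ?thesis using sgb_insert_joins[OF assms, of schema s] by blast
next
  case False
  then have "C \<in> set (sgb_insert schema s cs)"
    using assms by (auto simp: sgb_insert_def)
  then show ?thesis by blast
qed

lemma sgb_insert_self:
  "\<exists>C \<in> set (sgb_insert schema s cs). s \<in> set (members C)"
proof (cases "\<exists>C \<in> set cs. schema s \<subseteq> schema (center C)")
  case True
  then obtain C where "C \<in> set cs" "schema s \<subseteq> schema (center C)"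
    by blast
  then show ?thesis
    using sgb_insert_joins[of C cs schema s] by auto
next
  case False
  then show ?thesis by (simp add: sgb_insert_def)
qed

text \<open>The order hypothesis keeps only what non-increasing size says about inclusions, so the
  induction involves no cardinalities. The case \<open>x = y\<close> is deliberately allowed: it
  provides a cluster for any single entry.\<close>

lemma sgb_clusters_share:
  assumes "sorted_wrt (\<lambda>x y. schema x \<subseteq> schema y \<longrightarrow> schema y \<subseteq> schema x) xs"
    and "x \<in> set xs" and "y \<in> set xs" and "schema y \<subseteq> schema x"
  shows "\<exists>C \<in> set (sgb_clusters schema xs). x \<in> set (members C) \<and> y \<in> set (members C)"
  using assms
proof (induction xs arbitrary: x y rule: rev_induct)
  case Nil
  then show ?case by simp
next
  case (snoc s xs)
  let ?cs = "sgb_clusters schema xs"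
  have sorted: "sorted_wrt (\<lambda>x y. schema x \<subseteq> schema y \<longrightarrow> schema y \<subseteq> schema x) xs"
    and last: "\<And>z. z \<in> set xs \<Longrightarrow> schema z \<subseteq> schema s \<Longrightarrow> schema s \<subseteq> schema z"
    using snoc.prems(1) by (auto simp: sorted_wrt_append)
  have with_last: "\<exists>C \<in> set (sgb_insert schema s ?cs). z \<in> set (members C) \<and> s \<in> set (members C)"
    if z: "z \<in> set xs" "schema s \<subseteq> schema z" for z
  proof -
    \<comment> \<open>The induction hypothesis is applied to the pair \<open>z\<close>,
      \<open>z\<close>. The center of the resulting cluster contains \<open>schema z\<close>, hence
      also \<open>schema s\<close>, so \<open>s\<close> joins it.\<close>
    obtain C where C: "C \<in> set ?cs" "z \<in> set (members C)"
      using snoc.IH[OF sorted z(1) z(1)] by blast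
    have "schema s \<subseteq> schema (center C)"
      using z(2) sgb_clusters_member_subset_center[OF C] by (rule subset_trans)
    then show ?thesis
      using sgb_insert_joins[of C ?cs schema s] C by auto
  qed
  consider "x \<in> set xs" "y \<in> set xs" | "x \<in> set xs" "y = s" | "x = s" "y \<in> set xs" | "x = s" "y = s"
    using snoc.prems(2,3) by auto
  then show ?case
  proof cases
    case 1
    then obtain C where "C \<in> set ?cs" "x \<in> set (members C)" "y \<in> set (members C)"
      using snoc.IH[OF sorted] snoc.prems(4) by blast
    then show ?thesis
      using sgb_insert_members_mono[of C ?cs schema s] by auto
  next
    case 2
    then show ?thesis
      using with_last snoc.prems(4) by simp
  next
    \<comment> \<open>Here the later entry \<open>s\<close> contains the earlier \<open>y\<close>.
      By \<open>last\<close> the two schemas coincide, so \<open>s\<close> joins a cluster of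
      \<open>y\<close> as well.\<close>
    case 3
    then show ?thesis
      using with_last[of y] last snoc.prems(4) by auto
  next
    case 4
    then show ?thesis
      using sgb_insert_self by auto
  qed
qed

theorem theorem4p1:
  fixes schema :: "'d \<Rightarrow> 'c set"
    and DS :: "'d set"
    and G :: "'d pair_pre_digraph"
  assumes "finite DS"
    and "\<And>D. D \<in> DS \<Longrightarrow> finite (schema D)"
    and "sgb_output schema DS G"
  shows "\<forall>A \<in> DS. \<forall>B \<in> DS. A \<noteq> B \<and> schema A \<subseteq> schema B \<longrightarrow> (B, A) \<in> parcs G"
proof -
  obtain xs where xs: "set xs = DS"
    and card: "sorted_wrt (\<lambda>x y. card (schema y) \<le> card (schema x)) xs"
    and G: "G = sgb_graph schema xs"
    using assms(3) by (auto simp: sgb_output_def sgb_order_def)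
  \<comment> \<open>A finite set has no proper subset of at least its own size; membership in
    \<open>xs\<close> supplies the finiteness of \<open>schema y\<close>.\<close>
  have "sorted_wrt (\<lambda>x y. schema x \<subseteq> schema y \<longrightarrow> schema y \<subseteq> schema x) xs"
  proof (rule sorted_wrt_mono_rel[OF _ card], intro impI)
    fix x y
    assume "y \<in> set xs" "card (schema y) \<le> card (schema x)" "schema x \<subseteq> schema y"
    then show "schema y \<subseteq> schema x"
      using assms(2) xs card_seteq[of "schema y" "schema x"] by simp
  qed
  then show ?thesis
    using sgb_clusters_share[of schema xs] xs by (auto simp: G sgb_graph_def)
qed

end
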